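(* Let $n$ be an integer with $2n\ge 6$, and let $Q$ be a simple, centrally symmetric spherical polygon in $\mathbb{S}^2$ with at least $2n$ vertices, such that either $Q$ is contained in a great circle, or no three consecutive vertices of $Q$ lie on a common great circle. Then $Q$ has at least 6 spherical inflections.
   Context: Let $m$ be the number of vertices of $Q$; indices are taken modulo $m$. A spherical polygon $Q=[u_1,\dots,u_m]$ on the unit sphere $\mathbb{S}^2\subset\mathbb{R}^3$ is the closed spherical polygonal line whose edges are the minimal-length great-circle segments joining $u_i$ to $u_{i+1}$, where consecutive vertices are not antipodal. It is simple (has no self-intersections) if its vertices are pairwise distinct, non-adjacent edges are disjoint, and adjacent edges meet only at their common vertex. It is centrally symmetric if $-Q=Q$, where $-Q=\{-x: x\in Q\}$. "No three consecutive vertices on a common great circle" means $\det(u_{i-1},u_i,u_{i+1})\neq 0$ for all $i$. A spherical inflection of $Q$ is a pair $\{u_i,u_{i+1}\}$ ($i$ modulo $m$) such that $u_{i-1}$ and $u_{i+2}$ are (strictly) on different sides of the plane spanned by $u_i,u_{i+1}$; equivalently, the determinants $[u_{i-1},u_i,u_{i+1}]$ and $[u_i,u_{i+1},u_{i+2}]$ have opposite signs. Convention: if the simple polygon $Q$ is contained in a great circle, then all of its $m$ edges $\{u_i,u_{i+1}\}$ are counted as spherical inflections. *)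

theory Defs
  imports "HOL-Analysis.Analysis" "HOL-Number_Theory.Cong"
begin

text \<open>A spherical polygon is given by the list of its vertices; \<open>vertex Q i\<close> reads the
  index \<open>i\<close> modulo the number of vertices.\<close>

definition vertex :: "(real^3) list \<Rightarrow> int \<Rightarrow> real^3" where
  "vertex Q i = Q ! nat (i mod int (length Q))"

text \<open>For distinct, non-antipodal unit vectors \<open>u\<close>, \<open>v\<close>, the part of the great circle through
  \<open>u\<close> and \<open>v\<close> that lies in the angle spanned by \<open>u\<close> and \<open>v\<close> is the great-circle segment of
  minimal length joining them.\<close>

definition great_circle_segment :: "real^3 \<Rightarrow> real^3 \<Rightarrow> (real^3) set" where
  "great_circle_segment u v =
     {x \<in> sphere 0 1. \<exists>a\<ge>0. \<exists>b\<ge>0. x = a *\<^sub>R u + b *\<^sub>R v}"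

definition spherical_polygon :: "(real^3) list \<Rightarrow> bool" where
  "spherical_polygon Q \<longleftrightarrow>
     Q \<noteq> [] \<and> set Q \<subseteq> sphere 0 1 \<and> (\<forall>i. vertex Q (i + 1) \<noteq> - vertex Q i)"

definition edge :: "(real^3) list \<Rightarrow> int \<Rightarrow> (real^3) set" where
  "edge Q i = great_circle_segment (vertex Q i) (vertex Q (i + 1))"

definition polygonal_line :: "(real^3) list \<Rightarrow> (real^3) set" where
  "polygonal_line Q = (\<Union>i. edge Q i)"

definition simple_polygon :: "(real^3) list \<Rightarrow> bool" where
  "simple_polygon Q \<longleftrightarrow>
     distinct Q \<and>
     (\<forall>i j. \<not> [j = i - 1] (mod int (length Q)) \<and> \<not> [j = i] (mod int (length Q)) \<and>
        \<not> [j = i + 1] (mod int (length Q)) \<longrightarrow> edge Q i \<inter> edge Q j = {}) \<and>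
     (\<forall>i. edge Q i \<inter> edge Q (i + 1) = {vertex Q (i + 1)})"

definition centrally_symmetric :: "(real^3) list \<Rightarrow> bool" where
  "centrally_symmetric Q \<longleftrightarrow> uminus ` polygonal_line Q = polygonal_line Q"

definition great_circle :: "(real^3) set \<Rightarrow> bool" where
  "great_circle C \<longleftrightarrow> (\<exists>w. w \<noteq> 0 \<and> C = {x \<in> sphere 0 1. w \<bullet> x = 0})"

definition in_great_circle :: "(real^3) list \<Rightarrow> bool" where
  "in_great_circle Q \<longleftrightarrow> (\<exists>C. great_circle C \<and> polygonal_line Q \<subseteq> C)"

definition no_three_consecutive_on_great_circle :: "(real^3) list \<Rightarrow> bool" where
  "no_three_consecutive_on_great_circle Q \<longleftrightarrow>
     (\<forall>i. det (vector [vertex Q (i - 1), vertex Q i, vertex Q (i + 1)] :: real^3^3) \<noteq> 0)"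

definition strictly_separated_by_plane :: "real^3 \<Rightarrow> real^3 \<Rightarrow> real^3 \<Rightarrow> real^3 \<Rightarrow> bool" where
  "strictly_separated_by_plane p q a b \<longleftrightarrow>
     (\<exists>w. span {p, q} = {x. w \<bullet> x = 0} \<and> w \<bullet> a < 0 \<and> 0 < w \<bullet> b)"

lemma strictly_separated_by_plane_iff_det:
  "strictly_separated_by_plane p q a b \<longleftrightarrow>
     det (vector [a, p, q] :: real^3^3) * det (vector [p, q, b] :: real^3^3) < 0"
proof -
  define c where "c = cross3 p q"
  have d: "det (vector [a, p, q] :: real^3^3) = c \<bullet> a"
          "det (vector [p, q, b] :: real^3^3) = c \<bullet> b"
    unfolding c_def by (simp_all add: cross3_simps)
  have cpq: "c \<bullet> p = 0" "c \<bullet> q = 0"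
    by (simp_all add: c_def dot_cross_self)
  have plane: "span {p, q} = {x. c \<bullet> x = 0}" if "c \<noteq> 0"
  proof (rule subspace_dim_equal)
    show "span {p, q} \<subseteq> {x. c \<bullet> x = 0}"
      by (rule span_minimal) (auto simp: cpq subspace_hyperplane)
    have nc: "\<not> collinear {0, p, q}"
      using that by (simp add: c_def cross_eq_0)
    then have "q \<noteq> 0" "p \<noteq> q"
      by (auto simp: collinear_lemma dest: spec[of _ 1])
    moreover have "p \<notin> span {q}"
      using nc by (auto simp: span_singleton insert_commute[of p q] collinear_lemma[of q p])
    ultimately have "independent {p, q}"
      by (intro independent_insertI) (auto simp: independent_empty)
    then have "dim (span {p, q}) = 2"
      using \<open>p \<noteq> q\<close> by (simp add: dim_eq_card_independent)
    then show "dim {x. c \<bullet> x = 0} \<le> dim (span {p, q})"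
      by (simp add: dim_hyperplane[OF that])
  qed (auto simp: subspace_hyperplane)
  show ?thesis
    unfolding strictly_separated_by_plane_def d
  proof
    assume "\<exists>w. span {p, q} = {x. w \<bullet> x = 0} \<and> w \<bullet> a < 0 \<and> 0 < w \<bullet> b"
    then obtain w where w: "span {p, q} = {x. w \<bullet> x = 0}" "w \<bullet> a < 0" "0 < w \<bullet> b"
      by blast
    have w0: "w \<noteq> 0" using w(2) by auto
    have wpq: "w \<bullet> p = 0" "w \<bullet> q = 0"
      using w(1) span_base[of _ "{p, q}"] by blast+
    have c0: "c \<noteq> 0"
    proof
      assume "c = 0"
      then have col: "collinear {0, p, q}" by (simp add: c_def cross_eq_0)
      have "\<exists>v. {p, q} \<subseteq> span {v}"
      proof (cases "p = 0")
        case True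
        then have "{p, q} \<subseteq> span {q}" by (simp add: span_base span_zero)
        then show ?thesis by blast
      next
        case False
        then obtain k where "q = k *\<^sub>R p"
          using col unfolding collinear_lemma by (metis scaleR_zero_left)
        then have "{p, q} \<subseteq> span {p}" by (simp add: span_base span_scale)
        then show ?thesis by blast
      qed
      then obtain v where "{p, q} \<subseteq> span {v}" by blast
      then have "dim {p, q} \<le> card {v}" by (rule dim_le_card) simp
      moreover have "dim {p, q} = 2"
        using dim_hyperplane[OF w0] w(1) dim_span[of "{p, q}"] by simp
      ultimately show False by simp
    qed
    have "cross3 w c = 0"
      by (simp add: c_def Lagrange wpq)
    then obtain k where k: "c = k *\<^sub>R w"
      using w0 c0 unfolding cross_eq_0 collinear_lemma by blast
    have "k \<noteq> 0" using k c0 by auto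
    have "(c \<bullet> a) * (c \<bullet> b) = k\<^sup>2 * ((w \<bullet> a) * (w \<bullet> b))"
      by (simp add: k power2_eq_square)
    moreover have "0 < k\<^sup>2" using \<open>k \<noteq> 0\<close> by simp
    moreover have "(w \<bullet> a) * (w \<bullet> b) < 0" using w(2,3) by (rule mult_neg_pos)
    ultimately show "(c \<bullet> a) * (c \<bullet> b) < 0" by (simp add: mult_pos_neg)
  next
    assume l: "(c \<bullet> a) * (c \<bullet> b) < 0"
    then have sp: "span {p, q} = {x. c \<bullet> x = 0}" by (intro plane) auto
    then have sp': "span {p, q} = {x. (- c) \<bullet> x = 0}" by simp
    from l consider "c \<bullet> a < 0" "0 < c \<bullet> b" | "0 < c \<bullet> a" "c \<bullet> b < 0"
      by (auto simp: mult_less_0_iff)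
    then show "\<exists>w. span {p, q} = {x. w \<bullet> x = 0} \<and> w \<bullet> a < 0 \<and> 0 < w \<bullet> b"
    proof cases
      case 1
      with sp show ?thesis by blast
    next
      case 2
      with sp' show ?thesis by (intro exI[of _ "- c"]) simp
    qed
  qed
qed

text \<open>By convention every edge of a polygon contained in a great circle is an inflection.\<close>

definition spherical_inflections :: "(real^3) list \<Rightarrow> (real^3) set set" where
  "spherical_inflections Q =
     {{vertex Q i, vertex Q (i + 1)} | i. i \<in> {0..<int (length Q)} \<and>
        (in_great_circle Q \<or>
         strictly_separated_by_plane (vertex Q i) (vertex Q (i + 1))
           (vertex Q (i - 1)) (vertex Q (i + 2)))}"

end

theory Submission imports Defs begin

text \<open>In the non-degenerate case the vertices are the points near which the polygonal line is not
  contained in a plane through the origin, so the antipodal map permutes vertices and edges. It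
  fixes neither a vertex nor an edge, hence it is the rotation of the indices by half of their
  number: there are $2k$ vertices, $u_{i+k} = -u_i$, and the determinants
  $d_i = [u_{i-1}, u_i, u_{i+1}]$ satisfy $d_{i+k} = -d_i$. So the number of sign changes in half a
  period is odd, and it suffices to exclude that it is one.

  This follows from the fact that a simple arc $u_0, \dots, u_k$ that turns left at all its inner
  vertices does not end in $-u_0$. As long as every edge has the hull of the preceding arc strictly
  on its left, the arc spirals outwards and $u_0$ stays strictly on the left of every edge, which is
  impossible for the last one if $u_k = -u_0$. As soon as an edge enters that hull, the arc can never
  leave it again, since it would have to cross one of its own edges. In that case a linear functional
  that is nonnegative on the hull and positive at $u_0$ shows that $u_k \neq -u_0$.\<close>

section \<open>Triple products and planar cones\<close>

abbreviation triple :: "real^3 \<Rightarrow> real^3 \<Rightarrow> real^3 \<Rightarrow> real" where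
  "triple a b c \<equiv> cross3 a b \<bullet> c"

text \<open>The radial cone over a great-circle segment. Signs of triple products ignore positive
  factors, so points of cones can stand in for unit vectors without normalisation.\<close>

definition cone2 :: "'a::real_vector \<Rightarrow> 'a \<Rightarrow> 'a set" where
  "cone2 x y = {a *\<^sub>R x + b *\<^sub>R y | a b. 0 \<le> a \<and> 0 \<le> b}"

lemma cone2I: "0 \<le> a \<Longrightarrow> 0 \<le> b \<Longrightarrow> a *\<^sub>R x + b *\<^sub>R y \<in> cone2 x y"
  by (auto simp: cone2_def)

lemma cone2_left: "x \<in> cone2 x y"
  using cone2I[of 1 0 x y] by simp

lemma cone2_combination:
  assumes "z \<in> cone2 x y" "0 \<le> a" "0 \<le> b"
  shows "a *\<^sub>R z + b *\<^sub>R y \<in> cone2 x y"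
proof -
  obtain c d where z: "z = c *\<^sub>R x + d *\<^sub>R y" "0 \<le> c" "0 \<le> d"
    using assms(1) by (auto simp: cone2_def)
  have "a *\<^sub>R z + b *\<^sub>R y = (a * c) *\<^sub>R x + (a * d + b) *\<^sub>R y"
    by (simp add: z algebra_simps)
  also have "\<dots> \<in> cone2 x y" using assms z by (intro cone2I) auto
  finally show ?thesis .
qed

lemma inner_cone2_nonneg:
  fixes v :: "'a::real_inner"
  shows "z \<in> cone2 x y \<Longrightarrow> 0 \<le> v \<bullet> x \<Longrightarrow> 0 \<le> v \<bullet> y \<Longrightarrow> 0 \<le> v \<bullet> z"
  by (auto simp: cone2_def inner_add_right)

lemma triple_rotate: "triple a b c = triple b c a"
  by (simp add: cross3_simps)

lemma triple_degenerate [simp]: "triple a b a = 0" "triple a b b = 0" "triple a a b = 0"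
  by (simp_all add: dot_cross_self)

text \<open>Both sides expand \<open>cross3 (cross3 c d) (cross3 a b)\<close>, a vector common to
  the plane of \<open>a\<close>, \<open>b\<close> and the plane of \<open>c\<close>,
  \<open>d\<close>. It gives the crossing point of two prolonged edges in terms of either pair of
  endpoints.\<close>

lemma triple_exchange:
  "triple a b c *\<^sub>R d - triple a b d *\<^sub>R c = triple c d b *\<^sub>R a - triple c d a *\<^sub>R b"
  by (simp add: vec_eq_iff forall_3 cross3_def inner_vec_def sum_3 vector_3) algebra

lemma triple_linear:
  "triple a b (x *\<^sub>R c + y *\<^sub>R d) = x * triple a b c + y * triple a b d"
  "triple a b (x *\<^sub>R c - y *\<^sub>R d) = x * triple a b c - y * triple a b d"
  by (simp_all add: inner_add_right inner_diff_right)

section \<open>Simple arcs that only turn left\<close>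

locale simple_arc =
  fixes u :: "nat \<Rightarrow> real^3" and k :: nat
  assumes left_turn: "i + 2 \<le> k \<Longrightarrow> triple (u i) (u (Suc i)) (u (i + 2)) > 0"
    and disjoint_edges:
      "b + 2 \<le> m \<Longrightarrow> m < k \<Longrightarrow> x \<in> cone2 (u b) (u (Suc b)) \<Longrightarrow>
        x \<in> cone2 (u m) (u (Suc m)) \<Longrightarrow> x = 0"
begin

text \<open>The points \<open>w a, w (a + 1), \<dots>, w m\<close> bound a convex region that the arc has just entered or is
  inside of: \<open>w p = u p\<close> for \<open>p > a\<close>, while \<open>w a\<close> is the point of the edge from \<open>u a\<close> to \<open>u (a + 1)\<close>
  (up to a positive factor) which the ray along the last edge of the arc hits next, or \<open>u a\<close> itself at the moment of entering.\<close>

definition trapped :: "(nat \<Rightarrow> real^3) \<Rightarrow> nat \<Rightarrow> nat \<Rightarrow> bool" where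
  "trapped w a m \<longleftrightarrow> a + 2 \<le> m \<and> (\<forall>l>a. w l = u l) \<and> w a \<in> cone2 (u a) (u (Suc a)) \<and>
     (\<forall>l p. a \<le> l \<and> l < m \<and> a \<le> p \<and> p \<le> m \<and> p \<noteq> l \<and> p \<noteq> Suc l \<and> \<not> (Suc l = m \<and> p = a)
        \<longrightarrow> triple (w l) (w (Suc l)) (w p) > 0) \<and>
     triple (w (m - 1)) (w m) (w a) \<ge> 0"

text \<open>The new edge, prolonged, leaves the convex region through one of its sides. Since the
  arc is simple, the edge itself cannot reach that side, so the exit point lies beyond
  \<open>u (Suc m)\<close>. Cutting the region along this ray leaves a region of the same
  kind.\<close>

lemma trapped_step:
  assumes tr: "trapped w a m" and mk: "m < k" and enter: "triple (u m) (u (Suc m)) (w a) \<le> 0"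
  obtains w' b A B where "a \<le> b" "b + 2 \<le> m" "trapped w' b (Suc m)"
    "w' b = B *\<^sub>R u (Suc m) - A *\<^sub>R u m" "A > 0" "B > 0"
proof -
  from tr have am: "a + 2 \<le> m" and wu: "\<And>l. l > a \<Longrightarrow> w l = u l"
    and wa: "w a \<in> cone2 (u a) (u (Suc a))"
    and pos: "\<And>l p. a \<le> l \<Longrightarrow> l < m \<Longrightarrow> a \<le> p \<Longrightarrow> p \<le> m \<Longrightarrow> p \<noteq> l \<Longrightarrow> p \<noteq> Suc l \<Longrightarrow>
       \<not> (Suc l = m \<and> p = a) \<Longrightarrow> triple (w l) (w (Suc l)) (w p) > 0"
    and last: "triple (w (m - 1)) (w m) (w a) \<ge> 0"
    unfolding trapped_def by blast+
  \<comment> \<open>\<open>b\<close> is the last vertex before \<open>u m\<close> that is not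
    strictly left of the new edge, so the prolonged edge leaves through the side from
    \<open>w b\<close> to \<open>u (Suc b)\<close>.\<close>
  define S where "S = {b. a \<le> b \<and> b + 2 \<le> m \<and> triple (u m) (u (Suc m)) (w b) \<le> 0}"
  define b where "b = Max S"
  have fin: "finite S" by (rule finite_subset[of _ "{..m}"]) (auto simp: S_def)
  have "a \<in> S" using am enter by (simp add: S_def)
  then have "b \<in> S" using fin unfolding b_def by (intro Max_in) auto
  then have b: "a \<le> b" "b + 2 \<le> m" and bneg: "triple (u m) (u (Suc m)) (w b) \<le> 0"
    by (auto simp: S_def)
  have turn: "triple (u (m - 1)) (u m) (u (Suc m)) > 0"
    using left_turn[of "m - 1"] am mk by (simp add: numeral_2_eq_2)
  have after: "triple (u m) (u (Suc m)) (u p) > 0" if "b < p" "p < m" for p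
  proof (cases "p + 2 \<le> m")
    case True
    then have "p \<notin> S" using that fin unfolding b_def by (metis Max_ge leD)
    then show ?thesis using True that b wu[of p] by (auto simp: S_def)
  next
    case False
    then have "p = m - 1" using that by auto
    then show ?thesis using turn by (simp add: triple_rotate)
  qed
  \<comment> \<open>\<open>z\<close> is the exit point as a combination of the ends of the side;
    \<open>A\<close> and \<open>B\<close> are its coordinates along the new edge, and the sign of
    \<open>A\<close> tells on which side of \<open>u (Suc m)\<close> it lies.\<close>
  define A B z where "A = triple (w b) (u (Suc b)) (u (Suc m))" and "B = triple (w b) (u (Suc b)) (u m)"
    and "z = triple (u m) (u (Suc m)) (u (Suc b)) *\<^sub>R w b - triple (u m) (u (Suc m)) (w b) *\<^sub>R u (Suc b)"
  have zAB: "z = B *\<^sub>R u (Suc m) - A *\<^sub>R u m"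
    unfolding z_def A_def B_def by (rule triple_exchange[symmetric])
  have B: "B > 0" using pos[of b m] b wu[of "Suc b"] wu[of m] by (simp add: B_def)
  have after_b: "triple (u m) (u (Suc m)) (u (Suc b)) > 0" using after[of "Suc b"] b by simp
  have wb: "w b \<in> cone2 (u b) (u (Suc b))"
    using wa b wu[of b] cone2_left[of "u b"] by (cases "b = a") auto
  have zc: "z \<in> cone2 (u b) (u (Suc b))"
    using cone2_combination[OF wb, of "triple (u m) (u (Suc m)) (u (Suc b))" "- triple (u m) (u (Suc m)) (w b)"]
      after_b bneg by (simp add: z_def)
  have A: "A > 0"
  proof (rule ccontr)
    assume "\<not> A > 0"
    \<comment> \<open>Otherwise \<open>z\<close> would lie in the cones of two disjoint edges and
      vanish, against the left turn at \<open>u m\<close>.\<close>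
    then have "z \<in> cone2 (u m) (u (Suc m))"
      using cone2I[of "- A" B "u m" "u (Suc m)"] B by (simp add: zAB)
    then have "z = 0" using disjoint_edges b mk zc by blast
    moreover have "triple (u (m - 1)) (u m) z = B * triple (u (m - 1)) (u m) (u (Suc m))"
      by (simp add: zAB triple_linear)
    ultimately show False using B turn by simp
  qed
  define w' where "w' = u(b := z)"
  have old: "triple (u l) (u (Suc l)) (u p) > 0"
    if "b < l" "l < m" "b < p" "p \<le> m" "p \<noteq> l" "p \<noteq> Suc l" for l p
    using pos[of l p] that b wu[of l] wu[of "Suc l"] wu[of p] by auto
  have weak: "triple (u l) (u (Suc l)) (w b) \<ge> 0" if "b < l" "l < m" for l
  proof (cases "Suc l = m \<and> b = a")
    case True
    then show ?thesis using last wu[of l] wu[of m] that by auto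
  next
    case False
    then show ?thesis using pos[of l b] that b wu[of l] wu[of "Suc l"] by force
  qed
  have toz: "triple (u l) (u (Suc l)) z > 0" if "b < l" "l < m" for l
  proof (cases "Suc l = m")
    case True
    then have l: "l = m - 1" by simp
    show ?thesis using B turn True unfolding l by (simp add: zAB triple_linear)
  next
    case False
    then have s: "triple (u l) (u (Suc l)) (w b) > 0"
      using pos[of l b] that b wu[of l] wu[of "Suc l"] by force
    have "triple (u l) (u (Suc l)) (u (Suc b)) \<ge> 0"
      using old[of l "Suc b"] that b by (cases "l = Suc b") force+
    then show ?thesis unfolding z_def triple_linear
      using s after_b bneg by (smt (verit) mult_pos_pos mult_nonpos_nonneg)
  qed
  have tonew: "triple (u l) (u (Suc l)) (u (Suc m)) > 0" if "b < l" "l < m" for l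
  proof (cases "Suc l = m")
    case True
    then have l: "l = m - 1" by simp
    show ?thesis using turn True unfolding l by simp
  next
    case False
    \<comment> \<open>The new vertex lies between \<open>u m\<close> and \<open>z\<close> and
      inherits the strict inequalities of both.\<close>
    have "u (Suc m) = (1 / B) *\<^sub>R (z + A *\<^sub>R u m)" using B by (simp add: zAB)
    then have "triple (u l) (u (Suc l)) (u (Suc m))
        = (triple (u l) (u (Suc l)) z + A * triple (u l) (u (Suc l)) (u m)) / B"
      by (simp add: inner_add_right)
    moreover have "triple (u l) (u (Suc l)) (u m) > 0" using old[of l m] that b False by simp
    ultimately show ?thesis using toz[OF that] A B by (simp add: add_pos_pos)
  qed
  \<comment> \<open>\<open>z\<close> is a positive multiple of \<open>w b\<close> plus a multiple of
    \<open>u (Suc b)\<close>, and the latter drops out of the product.\<close>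
  have fromz: "triple z (u (Suc b)) x = triple (u m) (u (Suc m)) (u (Suc b)) * triple (w b) (u (Suc b)) x" for x
    unfolding z_def by (simp add: cross3_simps)
  have "trapped w' b (Suc m)"
    unfolding trapped_def
  proof (intro conjI allI impI, goal_cases)
    case (4 l p)
    consider "l = b" "p = Suc m" | "l = b" "p < Suc m" | "l = m" "p \<noteq> b" | "l \<noteq> b" "l \<noteq> m" "p = b"
      | "l \<noteq> b" "l \<noteq> m" "p = Suc m" | "l \<noteq> b" "l \<noteq> m" "p \<noteq> b" "p \<noteq> Suc m"
      using 4 by linarith
    then show ?case
    proof cases
      case 1
      then show ?thesis using A after_b 4 b by (simp add: w'_def fromz A_def)
    next
      case 2
      then have "triple (w b) (u (Suc b)) (u p) > 0"
        using pos[of b p] 4 b wu[of "Suc b"] wu[of p] by simp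
      then show ?thesis using 2 after_b 4 b by (simp add: w'_def fromz)
    next
      case 3
      then show ?thesis using after[of p] 4 b by (simp add: w'_def)
    next
      case 4: 4
      then show ?thesis using toz[of l] \<open>b \<le> l \<and> _\<close> by (simp add: w'_def)
    next
      case 5
      then show ?thesis using tonew[of l] 4 by (simp add: w'_def)
    next
      case 6
      then show ?thesis using old[of l p] 4 by (simp add: w'_def)
    qed
  qed (use b zc in \<open>auto simp: w'_def zAB triple_linear\<close>)
  moreover have "w' b = B *\<^sub>R u (Suc m) - A *\<^sub>R u m" by (simp add: w'_def zAB)
  ultimately show thesis using that b A B by blast
qed

text \<open>Each new vertex lies between the previous one and an exit point on an earlier edge, so a
  functional that is nonnegative on the region stays nonnegative along the rest of the arc. The
  induction runs over the number of remaining edges.\<close>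

lemma trapped_stays:
  assumes "trapped w a m" "m < k" "triple (u m) (u (Suc m)) (w a) \<le> 0"
    "\<And>q. a \<le> q \<Longrightarrow> q \<le> m \<Longrightarrow> 0 \<le> v \<bullet> u q"
  shows "0 \<le> v \<bullet> u k"
  using assms
proof (induction "k - m" arbitrary: w a m)
  case 0
  then show ?case by simp
next
  case (Suc n)
  obtain w' b A B where s: "a \<le> b" "b + 2 \<le> m" "trapped w' b (Suc m)"
    "w' b = B *\<^sub>R u (Suc m) - A *\<^sub>R u m" "A > 0" "B > 0"
    using trapped_step[OF Suc.prems(1-3)] .
  have "w' b \<in> cone2 (u b) (u (Suc b))" using s(3) by (simp add: trapped_def)
  then have "0 \<le> v \<bullet> w' b" 
    using inner_cone2_nonneg[of "w' b" _ _ v] Suc.prems(4)[of b] Suc.prems(4)[of "Suc b"] s(1,2) by auto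
  then have "0 \<le> B * (v \<bullet> u (Suc m)) - A * (v \<bullet> u m)" using s(4) by (simp add: inner_diff_right)
  moreover have "0 \<le> A * (v \<bullet> u m)" using Suc.prems(4)[of m] s by simp
  ultimately have new: "0 \<le> v \<bullet> u (Suc m)" using s(6)
    by (smt (verit) mult_pos_neg)
  show ?case
  proof (cases "Suc m = k")
    case True
    then show ?thesis using new by simp
  next
    case False
    have "triple (u m) (u (Suc m)) (u (m + 2)) > 0" using left_turn[of m] False Suc.prems(2) by simp
    then have t: "triple (u (Suc m)) (u (Suc (Suc m))) (u m) > 0"
      by (simp add: triple_rotate[of "u m"])
    show ?thesis
    proof (rule Suc.hyps(1)[of "Suc m" w' b])
      \<comment> \<open>The left turn puts \<open>u m\<close> on the left of the next edge, hence
        \<open>w' b\<close>, which lies beyond \<open>u (Suc m)\<close> as seen from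
        \<open>u m\<close>, on its right: the arc is again entering the region.\<close>
      show "triple (u (Suc m)) (u (Suc (Suc m))) (w' b) \<le> 0"
        using t s(5) by (simp add: s(4) triple_linear)
      show "0 \<le> v \<bullet> u q" if "b \<le> q" "q \<le> Suc m" for q
        using that new Suc.prems(4)[of q] s(1) by (cases "q = Suc m") auto
    qed (use Suc False s in auto)
  qed
qed

text \<open>The convex polygon \<open>u i, \<dots>, u j\<close> is the hull of the arc up to \<open>u j\<close>. That \<open>u 0\<close> lies in it and is
  no multiple of \<open>u j\<close> is expressed through linear functionals.\<close>

definition spiral :: "nat \<Rightarrow> nat \<Rightarrow> bool" where
  "spiral i j \<longleftrightarrow> i + 2 \<le> j \<and>
     (\<forall>l p. i \<le> l \<and> l < j \<and> i \<le> p \<and> p \<le> j \<and> p \<noteq> l \<and> p \<noteq> Suc l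
        \<longrightarrow> triple (u l) (u (Suc l)) (u p) > 0) \<and>
     (\<forall>v. (\<forall>q. i \<le> q \<and> q < j \<longrightarrow> v \<bullet> u q > 0) \<and> v \<bullet> u j \<ge> 0 \<longrightarrow> v \<bullet> u 0 > 0) \<and>
     triple (u (j - 1)) (u j) (u 0) > 0"

text \<open>When the whole convex polygon is strictly left of the new edge, adding
  \<open>u (Suc j)\<close> makes the initial vertices up to some index \<open>p\<close> redundant:
  they are swallowed by the hull of the vertices from \<open>p\<close> on. The sides hidden in this
  way are those which do not have \<open>u (Suc j)\<close> strictly on their left.\<close>

lemma spiral_step:
  assumes sp: "spiral i j" and jk: "j < k"
    and ahead: "\<And>q. i \<le> q \<Longrightarrow> q < j \<Longrightarrow> triple (u j) (u (Suc j)) (u q) > 0"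
  shows "\<exists>p. spiral p (Suc j)"
proof -
  from sp have ij: "i + 2 \<le> j"
    and pos: "\<And>l p. i \<le> l \<Longrightarrow> l < j \<Longrightarrow> i \<le> p \<Longrightarrow> p \<le> j \<Longrightarrow> p \<noteq> l \<Longrightarrow> p \<noteq> Suc l \<Longrightarrow>
      triple (u l) (u (Suc l)) (u p) > 0"
    and origin: "\<And>v. (\<And>q. i \<le> q \<Longrightarrow> q < j \<Longrightarrow> v \<bullet> u q > 0) \<Longrightarrow> v \<bullet> u j \<ge> 0 \<Longrightarrow> v \<bullet> u 0 > 0"
    by (auto simp: spiral_def)
  define P where "P q \<longleftrightarrow> i \<le> q \<and> triple (u q) (u (Suc q)) (u (Suc j)) > 0" for q
  have turn: "triple (u (j - 1)) (u j) (u (Suc j)) > 0"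
    using left_turn[of "j - 1"] ij jk by (simp add: numeral_2_eq_2)
  then have "P (j - 1)" using ij by (simp add: P_def)
  define p where "p = (LEAST q. P q)"
  have Pp: "P p" and pj: "p \<le> j - 1"
    unfolding p_def using \<open>P (j - 1)\<close> by (auto intro: LeastI Least_le)
  have before: "triple (u q) (u (Suc q)) (u (Suc j)) \<le> 0" if "i \<le> q" "q < p" for q
    using not_less_Least[of q P] that by (auto simp: p_def P_def)
  \<comment> \<open>This is the exchange identity for the edges at \<open>q\<close> and
    \<open>j\<close>, solved for \<open>u q\<close>. It writes \<open>u q\<close> through
    \<open>u (Suc j)\<close>, \<open>u j\<close> and \<open>u (Suc q)\<close>, with coefficients of
    known sign.\<close>
  have exch: "triple (u j) (u (Suc j)) (u (Suc q)) *\<^sub>R u q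
      = triple (u q) (u (Suc q)) (u j) *\<^sub>R u (Suc j) - triple (u q) (u (Suc q)) (u (Suc j)) *\<^sub>R u j
        + triple (u j) (u (Suc j)) (u q) *\<^sub>R u (Suc q)" for q
    using triple_exchange[of "u q" "u (Suc q)" "u j" "u (Suc j)"] by (simp add: algebra_simps)
  have ivl: "triple (u q) (u (Suc q)) (u (Suc j)) > 0" if "p \<le> q" "q < j" for q
    using that
  proof (induction q rule: dec_induct)
    case base
    then show ?case using Pp by (simp add: P_def)
  next
    case (step q)
    have ip: "i \<le> p" using Pp by (simp add: P_def)
    show ?case
    proof (rule ccontr)
      assume neg: "\<not> triple (u (Suc q)) (u (Suc (Suc q))) (u (Suc j)) > 0"
      then have qj: "Suc (Suc q) < j" using turn step.prems
        by (metis Suc_lessI diff_Suc_1)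
      \<comment> \<open>The functional of the edge at \<open>q\<close> vanishes at
        \<open>u (Suc q)\<close>. Applied to \<open>exch\<close> for \<open>Suc q\<close>, it would
        turn a sum of nonnegative terms, some of them positive, into zero.\<close>
      let ?f = "cross3 (u q) (u (Suc q))"
      have "0 = ?f \<bullet> (triple (u j) (u (Suc j)) (u (Suc (Suc q))) *\<^sub>R u (Suc q))" by simp
      also have "\<dots> = triple (u (Suc q)) (u (Suc (Suc q))) (u j) * (?f \<bullet> u (Suc j))
          - triple (u (Suc q)) (u (Suc (Suc q))) (u (Suc j)) * (?f \<bullet> u j)
          + triple (u j) (u (Suc j)) (u (Suc q)) * (?f \<bullet> u (Suc (Suc q)))"
        unfolding exch by (simp add: inner_add_right inner_diff_right)
      finally have "0 = \<dots>" .
      moreover have "triple (u (Suc q)) (u (Suc (Suc q))) (u j) > 0"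
        "?f \<bullet> u j > 0" "?f \<bullet> u (Suc (Suc q)) > 0"
        using pos[of "Suc q" j] pos[of q j] pos[of q "Suc (Suc q)"] qj ip step.hyps by auto
      moreover have "triple (u j) (u (Suc j)) (u (Suc q)) > 0" "?f \<bullet> u (Suc j) > 0"
        using ahead[of "Suc q"] step ip by auto
      ultimately show False using neg
        by (smt (verit) mult_pos_pos mult_nonpos_nonneg)
    qed
  qed
  have removed: "v \<bullet> u q > 0"
    if v: "\<And>q. p \<le> q \<Longrightarrow> q < Suc j \<Longrightarrow> v \<bullet> u q > 0" "v \<bullet> u (Suc j) \<ge> 0" and q: "i \<le> q" "q \<le> p" for v q
    using q(2,1)
  proof (induction q rule: inc_induct)
    case base
    then show ?case using v(1)[of p] pj by simp
  next
    case (step q)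
    have "triple (u j) (u (Suc j)) (u (Suc q)) * (v \<bullet> u q)
      = v \<bullet> (triple (u j) (u (Suc j)) (u (Suc q)) *\<^sub>R u q)" by simp
    also have "\<dots> = triple (u q) (u (Suc q)) (u j) * (v \<bullet> u (Suc j))
        - triple (u q) (u (Suc q)) (u (Suc j)) * (v \<bullet> u j)
        + triple (u j) (u (Suc j)) (u q) * (v \<bullet> u (Suc q))"
      unfolding exch by (simp add: inner_add_right inner_diff_right)
    also have "\<dots> > 0"
    proof -
      have "triple (u q) (u (Suc q)) (u j) > 0" using pos[of q j] step pj by auto
      moreover have "triple (u q) (u (Suc q)) (u (Suc j)) \<le> 0" using before step by simp
      moreover have "triple (u j) (u (Suc j)) (u q) > 0" using ahead[of q] step pj ij by auto
      moreover have "v \<bullet> u j > 0" using v(1)[of j] pj by simp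
      moreover have "v \<bullet> u (Suc q) > 0" using step by simp
      ultimately show ?thesis using v(2)
        by (smt (verit) mult_pos_pos mult_nonpos_nonneg mult_nonneg_nonneg)
    qed
    finally have "triple (u j) (u (Suc j)) (u (Suc q)) * (v \<bullet> u q) > 0" .
    moreover have "triple (u j) (u (Suc j)) (u (Suc q)) > 0" using ahead[of "Suc q"] step pj ij by auto
    ultimately show ?case by (simp add: zero_less_mult_iff)
  qed
  have "spiral p (Suc j)"
    unfolding spiral_def
  proof (intro conjI allI impI, goal_cases)
    case 1
    then show ?case using pj ij by simp
  next
    case (2 l q)
    have "i \<le> p" using Pp by (simp add: P_def)
    then show ?case using 2 ivl[of l] ahead[of q] pos[of l q]
      by (cases "l = j"; cases "q = Suc j") auto
  next
    case (3 v)
    then have v: "\<And>q. p \<le> q \<Longrightarrow> q < Suc j \<Longrightarrow> v \<bullet> u q > 0" "v \<bullet> u (Suc j) \<ge> 0" by auto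
    show ?case
    proof (rule origin)
      show "v \<bullet> u q > 0" if "i \<le> q" "q < j" for q
        using that removed[OF v, of q] v(1)[of q] by (cases "q \<le> p") auto
      show "v \<bullet> u j \<ge> 0" using v(1)[of j] pj by (simp add: less_imp_le)
    qed
  next
    case 4
    \<comment> \<open>This functional vanishes at \<open>u j\<close> and is positive at the other
      vertices of the old polygon; this is the case for which \<open>spiral\<close> asks only a weak
      inequality at the last vertex.\<close>
    then show ?case using origin[of "cross3 (u j) (u (Suc j))"] ahead by simp
  qed
  then show ?thesis ..
qed

theorem endpoint_not_antipodal:
  assumes "k \<ge> 2"
  shows "u k \<noteq> - u 0"
proof
  assume anti: "u k = - u 0"
  have "\<exists>i. spiral i j" if "2 \<le> j" "j \<le> k" for j
    using that
  proof (induction j rule: dec_induct)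
    case base
    have t: "triple (u 0) (u 1) (u 2) > 0" using left_turn[of 0] assms by (simp add: numeral_2_eq_2)
    then have t': "triple (u 1) (u 2) (u 0) > 0" by (simp add: triple_rotate)
    have "spiral 0 2"
      unfolding spiral_def
    proof (intro conjI allI impI, goal_cases)
      case (2 l p)
      then have "l = 0 \<and> p = 2 \<or> l = 1 \<and> p = 0" by auto
      then show ?case using t t' by (auto simp: numeral_2_eq_2)
    qed (use t' in auto)
    then show ?case ..
  next
    case (step j)
    then obtain i where i: "spiral i j" by auto
    show ?case
    proof (rule spiral_step[OF i], goal_cases)
      case 1
      then show ?case using step by simp
    next
      case (2 q)
      show ?case
      proof (rule ccontr)
        assume "\<not> ?thesis"
        then have enter: "triple (u j) (u (Suc j)) (u q) \<le> 0" by simp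
        have "triple (u (j - 1)) (u j) (u (Suc j)) > 0"
          using left_turn[of "j - 1"] step by (simp add: numeral_2_eq_2)
        then have "q \<noteq> j - 1" using enter triple_rotate[of "u (j - 1)" "u j" "u (Suc j)"] by auto
        then have qj: "q + 2 \<le> j" using 2 by simp
        have pos: "triple (u l) (u (Suc l)) (u p) > 0"
          if "i \<le> l" "l < j" "i \<le> p" "p \<le> j" "p \<noteq> l" "p \<noteq> Suc l" for l p
          using i that by (auto simp: spiral_def)
        have final: "triple (u (j - 1)) (u j) (u p) \<ge> 0" if "q \<le> p" "p \<le> j" for p
        proof (cases "p = j \<or> p = j - 1")
          case False
          have "i \<le> j - 1" using qj 2 by linarith
          then show ?thesis using pos[of "j - 1" p] that qj 2 False by (simp add: less_imp_le)
        qed auto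
        \<comment> \<open>At the moment of entering, the region is the polygon from
          \<open>u q\<close> to \<open>u j\<close> itself. The functional of its last edge is
          nonnegative there, hence at \<open>u k\<close>, but positive at
          \<open>u 0\<close>.\<close>
        have "trapped u q j"
          unfolding trapped_def using qj pos final[of q] 2 cone2_left by auto
        then have "triple (u (j - 1)) (u j) (u k) \<ge> 0"
          using step enter final by (intro trapped_stays[of u q j]) auto
        moreover have "triple (u (j - 1)) (u j) (u 0) > 0" using i by (simp add: spiral_def)
        ultimately show False by (simp add: anti)
      qed
    qed
  qed
  then obtain i where "spiral i k" using assms by auto
  then have "triple (u (k - 1)) (u k) (u 0) > 0" by (simp add: spiral_def)
  then show False by (simp add: anti)
qed

end

section \<open>Great-circle segments as continuous paths\<close>

text \<open>The chord from \<open>x\<close> to \<open>y\<close>, projected radially to the sphere.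
  The parameter is not arc length; only continuity and the image matter.\<close>

definition great_arc :: "real^3 \<Rightarrow> real^3 \<Rightarrow> real \<Rightarrow> real^3" where
  "great_arc x y t = sgn ((1 - t) *\<^sub>R x + t *\<^sub>R y)"

lemma convex_combination_nonzero:
  fixes x y :: "'a::real_normed_vector"
  assumes "norm x = 1" "norm y = 1" "y \<noteq> - x" "0 \<le> t" "t \<le> 1"
  shows "(1 - t) *\<^sub>R x + t *\<^sub>R y \<noteq> 0"
proof
  assume z: "(1 - t) *\<^sub>R x + t *\<^sub>R y = 0"
  then have e: "(1 - t) *\<^sub>R x = - (t *\<^sub>R y)" by (simp add: add_eq_0_iff2)
  then have "norm ((1 - t) *\<^sub>R x) = norm (t *\<^sub>R y)" by simp
  then have "t = 1 / 2" using assms by simp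
  then have "(1 / 2) *\<^sub>R (x + y) = 0" using z unfolding \<open>t = 1 / 2\<close> by (simp add: scaleR_add_right)
  then show False using assms(3) by (simp add: add_eq_0_iff)
qed

lemma continuous_on_arc:
  assumes "norm x = 1" "norm y = 1" "y \<noteq> - x"
  shows "continuous_on {0..1} (great_arc x y)"
  unfolding great_arc_def using convex_combination_nonzero[OF assms]
  by (intro continuous_intros) auto

lemma arc_endpoints: "norm x = 1 \<Longrightarrow> great_arc x y 0 = x" "norm y = 1 \<Longrightarrow> great_arc x y 1 = y"
  by (simp_all add: great_arc_def sgn_div_norm)

lemma great_circle_segment_eq_arc:
  assumes "norm x = 1" "norm y = 1" "y \<noteq> - x"
  shows "great_circle_segment x y = great_arc x y ` {0..1}"
proof (intro equalityI subsetI)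
  fix p assume "p \<in> great_circle_segment x y"
  then obtain a b where p: "norm p = 1" "a \<ge> 0" "b \<ge> 0" "p = a *\<^sub>R x + b *\<^sub>R y"
    by (auto simp: great_circle_segment_def)
  have ab: "a + b > 0" using p by (cases "a = 0 \<and> b = 0") auto
  define t where "t = b / (a + b)"
  have "(a + b) *\<^sub>R ((1 - t) *\<^sub>R x + t *\<^sub>R y) = p"
    using ab by (simp add: p(4) t_def scaleR_add_right) (simp add: field_simps)
  then have "sgn p = great_arc x y t"
    unfolding great_arc_def using ab by (metis sgn_scaleR sgn_pos scaleR_one)
  moreover have "sgn p = p" using p(1) by (simp add: sgn_div_norm)
  moreover have "t \<in> {0..1}" using ab p by (simp add: t_def)
  ultimately show "p \<in> great_arc x y ` {0..1}" by auto
next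
  fix p assume "p \<in> great_arc x y ` {0..1}"
  then obtain t where t: "p = great_arc x y t" "0 \<le> t" "t \<le> 1" by auto
  let ?q = "(1 - t) *\<^sub>R x + t *\<^sub>R y"
  have "?q \<noteq> 0" using convex_combination_nonzero[OF assms t(2,3)] .
  then have "norm p = 1" by (simp add: t great_arc_def norm_sgn)
  moreover have "p = (inverse (norm ?q) * (1 - t)) *\<^sub>R x + (inverse (norm ?q) * t) *\<^sub>R y"
    by (simp add: t great_arc_def sgn_div_norm scaleR_add_right)
  ultimately show "p \<in> great_circle_segment x y"
    unfolding great_circle_segment_def mem_Collect_eq
    using t by (intro conjI exI[of _ "inverse (norm ?q) * (1 - t)"] exI[of _ "inverse (norm ?q) * t"]) auto
qed

text \<open>The cross products of the point with \<open>x\<close> and with \<open>y\<close> are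
  nonzero multiples of \<open>cross3 x y\<close>.\<close>

lemma arc_interior:
  assumes "cross3 x y \<noteq> 0" "0 < t" "t < 1"
  shows "great_arc x y t \<noteq> x" "great_arc x y t \<noteq> y"
proof -
  let ?q = "(1 - t) *\<^sub>R x + t *\<^sub>R y"
  have "cross3 x (great_arc x y t) = (t / norm ?q) *\<^sub>R cross3 x y"
    "cross3 (great_arc x y t) y = ((1 - t) / norm ?q) *\<^sub>R cross3 x y"
    by (simp_all add: great_arc_def sgn_div_norm cross_add_left cross_add_right cross_mult_left cross_mult_right
        divide_inverse_commute)
  moreover have "?q \<noteq> 0"
  proof
    assume "?q = 0"
    then have "cross3 x ?q = 0" by simp
    then have "t *\<^sub>R cross3 x y = 0" by (simp only: cross_add_right cross_mult_right) simp
    then show False using assms by simp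
  qed
  ultimately show "great_arc x y t \<noteq> x" "great_arc x y t \<noteq> y" using assms by auto
qed

text \<open>The identity in the proof expands \<open>w\<close> in the basis reciprocal to
  \<open>a\<close>, \<open>b\<close>, \<open>c\<close>.\<close>

lemma triple_orthogonal_eq_0:
  assumes "w \<bullet> a = 0" "w \<bullet> b = 0" "w \<bullet> c = 0" "triple a b c \<noteq> 0"
  shows "w = 0"
proof -
  have "triple a b c *\<^sub>R w = (w \<bullet> a) *\<^sub>R cross3 b c + (w \<bullet> b) *\<^sub>R cross3 c a + (w \<bullet> c) *\<^sub>R cross3 a b"
    by (simp add: vec_eq_iff forall_3 cross3_def inner_vec_def sum_3 vector_3) algebra
  then show ?thesis using assms by simp
qed

lemma connected_subset_of_finite_cover:
  assumes "connected S" "finite I" "\<And>i. i \<in> I \<Longrightarrow> closed (F i)" "S \<subseteq> (\<Union>i\<in>I. F i)" "S \<noteq> {}"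
    and disj: "\<And>i j. i \<in> I \<Longrightarrow> j \<in> I \<Longrightarrow> i \<noteq> j \<Longrightarrow> S \<inter> F i \<inter> F j = {}"
  shows "\<exists>i\<in>I. S \<subseteq> F i"
proof -
  obtain i where i: "i \<in> I" "F i \<inter> S \<noteq> {}" using assms(4,5) by blast
  let ?G = "\<Union>j\<in>I - {i}. F j"
  have "F i \<inter> ?G \<inter> S = {}" using disj[OF i(1)] by blast
  moreover have "S \<subseteq> F i \<union> ?G" using assms(4) i by blast
  moreover have "closed ?G" using assms(2,3) by (intro closed_UN) auto
  ultimately have "?G \<inter> S = {}"
    using connected_closedD[OF assms(1), of "F i" ?G] assms(3) i by blast
  then show ?thesis using \<open>S \<subseteq> F i \<union> ?G\<close> i by blast
qed

section \<open>Indices modulo the number of vertices\<close>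

lemma vertex_cong: "[i = j] (mod int (length Q)) \<Longrightarrow> vertex Q i = vertex Q j"
  by (simp add: vertex_def cong_def)

lemma edge_cong:
  assumes "[i = j] (mod int (length Q))" shows "edge Q i = edge Q j"
  using vertex_cong[OF assms] vertex_cong[OF cong_add[OF assms cong_refl, of 1]] by (simp add: edge_def)

lemma vertex_in_edge:
  assumes "spherical_polygon Q"
  shows "norm (vertex Q i) = 1" "vertex Q i \<in> edge Q i"
proof -
  have n: "norm (vertex Q i) = 1" for i
  proof -
    have "Q \<noteq> []" using assms by (simp add: spherical_polygon_def)
    then have "vertex Q i \<in> set Q" unfolding vertex_def by (intro nth_mem) (simp add: nat_less_iff)
    then show ?thesis using assms by (auto simp: spherical_polygon_def)
  qed
  then show "norm (vertex Q i) = 1" .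
  have "vertex Q i = 1 *\<^sub>R vertex Q i + 0 *\<^sub>R vertex Q (i + 1)" by simp
  then show "vertex Q i \<in> edge Q i"
    unfolding edge_def great_circle_segment_def using n zero_le_one by fastforce
qed

lemma vertex_eq_iff:
  assumes "distinct Q" "Q \<noteq> []"
  shows "vertex Q i = vertex Q j \<longleftrightarrow> [i = j] (mod int (length Q))"
proof -
  have "0 \<le> i mod int (length Q)" "i mod int (length Q) < int (length Q)" for i
    using assms(2) by simp_all
  then show ?thesis
    using assms(1) by (simp add: vertex_def nth_eq_iff_index_eq nat_less_iff cong_def eq_nat_nat_iff)
qed

section \<open>The non-degenerate symmetric polygon\<close>

locale symmetric_polygon =
  fixes Q :: "(real^3) list"
  assumes spherical: "spherical_polygon Q" and simple: "simple_polygon Q"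
    and symmetric: "centrally_symmetric Q" and long: "length Q \<ge> 6"
    and generic: "no_three_consecutive_on_great_circle Q"
begin

abbreviation "u \<equiv> vertex Q"
abbreviation "m \<equiv> int (length Q)"

lemma m: "m \<ge> 6" using long by simp

lemma mod_m: "0 \<le> i mod m" "i mod m < m"
proof -
  have "0 < m" using m by linarith
  then show "0 \<le> i mod m" "i mod m < m" by (rule pos_mod_sign, rule pos_mod_bound)
qed

lemma norm_u: "norm (u i) = 1" and u_in_edge: "u i \<in> edge Q i"
  using vertex_in_edge[OF spherical] by auto

lemma u_neq_uminus: "u i \<noteq> - u i"
proof
  assume "u i = - u i"
  then have "u i \<bullet> u i = - (u i \<bullet> u i)" by (metis inner_minus_left)
  then show False using norm_u[of i] by (simp add: norm_eq_1)
qed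

lemma not_antipodal: "u (i + 1) \<noteq> - u i"
  using spherical by (simp add: spherical_polygon_def)

lemma u_eq_iff: "u i = u j \<longleftrightarrow> [i = j] (mod m)"
  using simple long by (intro vertex_eq_iff) (auto simp: simple_polygon_def)

lemma triple_nonzero: "triple (u (i - 1)) (u i) (u (i + 1)) \<noteq> 0"
proof -
  have "det (vector [u (i - 1), u i, u (i + 1)] :: real^3^3) \<noteq> 0"
    using generic by (simp add: no_three_consecutive_on_great_circle_def)
  then show ?thesis by (simp add: cross3_simps)
qed

lemma cross_nonzero: "cross3 (u i) (u (i + 1)) \<noteq> 0"
  using triple_nonzero[of "i + 1"] by auto

lemma edge_eq_arc: "edge Q i = great_arc (u i) (u (i + 1)) ` {0..1}"
  unfolding edge_def by (rule great_circle_segment_eq_arc[OF norm_u norm_u not_antipodal])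

lemma continuous_on_edge_arc: "continuous_on {0..1} (great_arc (u i) (u (i + 1)))"
  by (rule continuous_on_arc[OF norm_u norm_u not_antipodal])

lemma closed_edge: "closed (edge Q i)"
  unfolding edge_eq_arc
  by (intro compact_imp_closed compact_continuous_image continuous_on_edge_arc compact_Icc)

lemma polygonal_line_eq: "polygonal_line Q = (\<Union>i\<in>{0..<m}. edge Q i)"
proof -
  have "edge Q i \<subseteq> (\<Union>i\<in>{0..<m}. edge Q i)" for i
  proof -
    have "edge Q i = edge Q (i mod m)" by (rule edge_cong) (simp add: cong_def)
    moreover have "0 \<le> i mod m" "i mod m < m" by (rule mod_m)+
    ultimately show ?thesis by (metis UN_upper atLeastLessThan_iff)
  qed
  then show ?thesis by (auto simp: polygonal_line_def)
qed

lemma edge_Int_edge: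
  assumes "\<not> [i = j] (mod m)" "x \<in> edge Q i" "x \<in> edge Q j"
  shows "x \<in> range u"
proof -
  consider "[j = i - 1] (mod m)" | "[j = i + 1] (mod m)"
    using assms simple unfolding simple_polygon_def by (metis cong_sym disjoint_iff)
  then show ?thesis
  proof cases
    case 1
    then have "x \<in> edge Q (i - 1)" using assms edge_cong by blast
    then have "x \<in> edge Q (i - 1) \<inter> edge Q (i - 1 + 1)" using assms by simp
    then show ?thesis using simple unfolding simple_polygon_def by blast
  next
    case 2
    then have "x \<in> edge Q i \<inter> edge Q (i + 1)" using assms edge_cong by blast
    then show ?thesis using simple unfolding simple_polygon_def by blast
  qed
qed

text \<open>The edge starting at \<open>u i\<close> meets edge \<open>j\<close> in
  \<open>u i\<close>, and simplicity then leaves only the two edges that end or start there.\<close>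

lemma vertex_on_edge:
  assumes "u i \<in> edge Q j" shows "u i = u j \<or> u i = u (j + 1)"
proof (rule ccontr)
  assume "\<not> ?thesis"
  then have ne: "\<not> [j = i] (mod m)" "\<not> [j = i - 1] (mod m)" "u i \<noteq> u (j + 1)"
    using u_eq_iff[of i j] u_eq_iff[of i "j + 1"] cong_add_rcancel[of j 1 "i - 1" m]
    by (auto simp: cong_sym_eq)
  show False
  proof (cases "[j = i + 1] (mod m)")
    case True
    then have "u i \<in> edge Q i \<inter> edge Q (i + 1)" using assms edge_cong u_in_edge by blast
    then have "u i = u (i + 1)" using simple unfolding simple_polygon_def by blast
    then show ?thesis using True ne \<open>\<not> (u i = u j \<or> _)\<close> vertex_cong by metis
  next
    case False
    then show ?thesis using ne assms simple u_in_edge[of i] unfolding simple_polygon_def by blast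
  qed
qed

text \<open>Vertices are recognised inside the point set \<open>polygonal_line Q\<close> as the points near which it
  does not lie in one plane through the origin; hence the antipodal map permutes them.\<close>

definition flat_at :: "real^3 \<Rightarrow> bool" where
  "flat_at x \<longleftrightarrow> (\<exists>w \<epsilon>. w \<noteq> 0 \<and> 0 < \<epsilon> \<and> (\<forall>y \<in> polygonal_line Q. dist y x < \<epsilon> \<longrightarrow> w \<bullet> y = 0))"

lemma flat_at_uminus:
  assumes "flat_at x" shows "flat_at (- x)"
proof -
  obtain w e where we: "w \<noteq> 0" "0 < e" "\<And>y. y \<in> polygonal_line Q \<Longrightarrow> dist y x < e \<Longrightarrow> w \<bullet> y = 0"
    using assms by (auto simp: flat_at_def)
  have "w \<bullet> y = 0" if "y \<in> polygonal_line Q" "dist y (- x) < e" for y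
  proof -
    have "- y \<in> polygonal_line Q" using that(1) symmetric unfolding centrally_symmetric_def by force
    moreover have "dist (- y) x < e" using that(2) by (metis dist_minus minus_minus)
    ultimately show ?thesis using we(3)[of "- y"] by simp
  qed
  then show ?thesis using we by (auto simp: flat_at_def)
qed

text \<open>The finitely many edges that miss \<open>x\<close> stay at a positive distance from it,
  and only one edge passes through \<open>x\<close>. Near \<open>x\<close> the line therefore lies
  in the plane of that edge.\<close>

lemma flat_at_non_vertex:
  assumes "x \<in> polygonal_line Q" "x \<notin> range u"
  shows "flat_at x"
proof -
  obtain b where b: "x \<in> edge Q b" using assms(1) by (auto simp: polygonal_line_def)
  define F where "F = (\<Union>c \<in> {0..<m} \<inter> {c. x \<notin> edge Q c}. edge Q c)"
  have "closed F" unfolding F_def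
    by (intro closed_UN) (simp_all add: closed_edge)
  moreover have "x \<notin> F" by (auto simp: F_def)
  ultimately obtain e where e: "e > 0" "\<And>y. dist y x < e \<Longrightarrow> y \<notin> F"
    by (metis (no_types, lifting) Compl_iff open_Compl open_dist)
  have "cross3 (u b) (u (b + 1)) \<bullet> y = 0" if y: "y \<in> polygonal_line Q" "dist y x < e" for y
  proof -
    obtain c where c: "c \<in> {0..<m}" "y \<in> edge Q c" using y(1) by (auto simp: polygonal_line_eq)
    then have "x \<in> edge Q c" using e(2)[OF y(2)] by (auto simp: F_def)
    then have "[b = c] (mod m)" using edge_Int_edge[OF _ b] assms(2) by blast
    then have "y \<in> edge Q b" using c edge_cong by blast
    then show ?thesis
      by (auto simp: edge_def great_circle_segment_def inner_add_right dot_cross_self)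
  qed
  then show ?thesis using e(1) cross_nonzero unfolding flat_at_def by blast
qed

lemma arc_eventually_near:
  assumes "e > 0" "norm x = 1" "norm y = 1" "y \<noteq> - x"
  obtains t where "0 < t" "t < 1" "dist (great_arc x y t) x < e"
proof -
  obtain d where d: "d > 0" "\<And>t. t \<in> {0..1} \<Longrightarrow> dist t 0 < d \<Longrightarrow> dist (great_arc x y t) (great_arc x y 0) < e"
    using continuous_on_arc[OF assms(2-4)] assms(1) unfolding continuous_on_iff
    by (metis atLeastAtMost_iff order_refl zero_le_one)
  define t where "t = min (d / 2) (1 / 2)"
  have "0 < t" "t < 1" "dist t 0 < d" using d(1) by (auto simp: t_def)
  then show ?thesis using that d(2)[of t] arc_endpoints(1)[OF assms(2)] by simp
qed

lemma orthogonal_to_arc: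
  assumes "norm x = 1" "norm y = 1" "y \<noteq> - x" "0 < t" "t < 1" "w \<bullet> x = 0" "w \<bullet> great_arc x y t = 0"
  shows "w \<bullet> y = 0"
proof -
  let ?q = "(1 - t) *\<^sub>R x + t *\<^sub>R y"
  have "?q \<noteq> 0" using convex_combination_nonzero[OF assms(1-3)] assms by simp
  then have "w \<bullet> ?q = 0" using assms(7) by (simp add: great_arc_def sgn_div_norm)
  then show ?thesis using assms by (simp add: inner_add_right)
qed

lemma arc_commute: "great_arc x y t = great_arc y x (1 - t)"
  by (simp add: great_arc_def add.commute)

text \<open>A normal \<open>w\<close> to the line near \<open>u i\<close> is orthogonal to
  \<open>u i\<close> and to a further point on each of the two edges there, hence to both
  neighbours; three consecutive vertices are independent, so \<open>w = 0\<close>.\<close>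

lemma not_flat_at_vertex: "\<not> flat_at (u i)"
proof
  assume "flat_at (u i)"
  then obtain w e where we: "w \<noteq> 0" "0 < e"
    "\<And>y. y \<in> polygonal_line Q \<Longrightarrow> dist y (u i) < e \<Longrightarrow> w \<bullet> y = 0"
    by (auto simp: flat_at_def)
  have u0: "w \<bullet> u i = 0" using we(2) we(3)[of "u i"] u_in_edge[of i] by (auto simp: polygonal_line_def)
  have neighbour: "w \<bullet> y = 0"
    if y: "norm y = 1" "y \<noteq> - u i" "great_arc (u i) y ` {0..1} \<subseteq> polygonal_line Q" for y
  proof -
    obtain t where t: "0 < t" "t < 1" "dist (great_arc (u i) y t) (u i) < e"
      using arc_eventually_near[OF we(2) norm_u y(1,2)] .
    then show ?thesis
      using y(3) we(3)[of "great_arc (u i) y t"] orthogonal_to_arc[OF norm_u y(1,2) t(1,2) u0]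
      by (simp add: image_subset_iff)
  qed
  have "w \<bullet> u (i + 1) = 0"
    using not_antipodal[of i] by (intro neighbour norm_u) (auto simp: edge_eq_arc polygonal_line_def)
  moreover have "w \<bullet> u (i - 1) = 0"
  proof (intro neighbour norm_u)
    show "u (i - 1) \<noteq> - u i" using not_antipodal[of "i - 1"] by auto
    have "great_arc (u i) (u (i - 1)) ` {0..1} \<subseteq> edge Q (i - 1)"
      unfolding edge_eq_arc by (subst arc_commute[abs_def]) auto
    then show "great_arc (u i) (u (i - 1)) ` {0..1} \<subseteq> polygonal_line Q" by (auto simp: polygonal_line_def)
  qed
  ultimately show False
    using triple_orthogonal_eq_0[OF _ u0 _ triple_nonzero[of i]] we(1) by simp
qed

section \<open>The antipodal map on vertices, edges and indices\<close>

lemma antipode_in_line: "x \<in> polygonal_line Q \<Longrightarrow> - x \<in> polygonal_line Q"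
  using symmetric unfolding centrally_symmetric_def by blast

lemma antipode_of_vertex: "- u i \<in> range u"
proof (rule ccontr)
  assume "- u i \<notin> range u"
  moreover have "- u i \<in> polygonal_line Q"
    using u_in_edge[of i] by (intro antipode_in_line) (auto simp: polygonal_line_def)
  ultimately have "flat_at (- u i)" by (rule flat_at_non_vertex[rotated])
  then show False using flat_at_uminus not_flat_at_vertex by force
qed

text \<open>The antipodal image of an open edge is connected and contains no vertex, so it lies in a
  single edge. That edge is closed and thus contains the images of both ends, which are distinct
  vertices on it.\<close>

lemma antipode_of_edge: "\<exists>b. {- u i, - u (i + 1)} = {u b, u (b + 1)}"
proof -
  define g where "g t = - great_arc (u i) (u (i + 1)) t" for t
  have cont: "continuous_on {0..1} g"
    unfolding g_def by (intro continuous_on_minus continuous_on_edge_arc)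
  define S where "S = g ` {0<..<1}"
  have nv: "S \<inter> range u = {}"
  proof -
    have False if t: "0 < t" "t < 1" and eq: "g t = u j" for t j
    proof -
      obtain l where l: "- u j = u l" using antipode_of_vertex[of j] by auto
      then have a: "great_arc (u i) (u (i + 1)) t = u l" using eq by (simp add: g_def minus_equation_iff)
      moreover have "u l \<in> edge Q i" unfolding edge_eq_arc a[symmetric] using t by auto
      ultimately show False using vertex_on_edge[of l i] arc_interior[OF cross_nonzero t, of i] by metis
    qed
    then show ?thesis by (auto simp: S_def)
  qed
  have "\<exists>b\<in>{0..<m}. S \<subseteq> edge Q b"
  proof (rule connected_subset_of_finite_cover)
    show "connected S" unfolding S_def
      by (intro connected_continuous_image continuous_on_subset[OF cont]) auto
    show "S \<subseteq> (\<Union>b\<in>{0..<m}. edge Q b)"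
    proof
      fix x assume "x \<in> S"
      then obtain t where t: "x = g t" "t \<in> {0..1}" by (auto simp: S_def)
      then have "- x \<in> edge Q i" by (simp add: g_def edge_eq_arc)
      then have "- x \<in> polygonal_line Q" by (auto simp: polygonal_line_def)
      then show "x \<in> (\<Union>b\<in>{0..<m}. edge Q b)"
        using antipode_in_line[of "- x"] by (simp add: polygonal_line_eq)
    qed
    show "S \<noteq> {}" by (simp add: S_def)
    show "S \<inter> edge Q b \<inter> edge Q c = {}" if "b \<in> {0..<m}" "c \<in> {0..<m}" "b \<noteq> c" for b c
    proof -
      have "\<not> [b = c] (mod m)" using that by (auto simp: cong_def)
      then show ?thesis using edge_Int_edge nv by blast
    qed
  qed (auto simp: closed_edge)
  then obtain b where b: "S \<subseteq> edge Q b" ..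
  have "g ` closure {0<..<1} \<subseteq> edge Q b"
    using b by (intro image_closure_subset closed_edge) (auto simp: S_def cont)
  then have "g 0 \<in> edge Q b" "g 1 \<in> edge Q b" by auto
  then have "- u i \<in> edge Q b" "- u (i + 1) \<in> edge Q b"
    by (simp_all add: g_def arc_endpoints norm_u)
  then have "- u i \<in> {u b, u (b + 1)}" "- u (i + 1) \<in> {u b, u (b + 1)}"
    using antipode_of_vertex vertex_on_edge by (metis insert_iff rangeE)+
  moreover have "- u i \<noteq> - u (i + 1)" using cross_nonzero[of i] by auto
  ultimately have "{- u i, - u (i + 1)} = {u b, u (b + 1)}"
    by (metis doubleton_eq_iff empty_iff insert_iff)
  then show ?thesis ..
qed

lemma neighbour_of_antipode:
  assumes "u a = - u i" shows "u (a + 1) = - u (i + 1) \<or> u (a - 1) = - u (i + 1)"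
proof -
  obtain b where b: "{- u i, - u (i + 1)} = {u b, u (b + 1)}" using antipode_of_edge by blast
  then consider "- u i = u b" "- u (i + 1) = u (b + 1)" | "- u i = u (b + 1)" "- u (i + 1) = u b"
    by (auto simp: doubleton_eq_iff)
  then show ?thesis
  proof cases
    case 1
    then have "[a = b] (mod m)" using assms u_eq_iff by metis
    then have "u (a + 1) = u (b + 1)" by (intro vertex_cong cong_add) auto
    then show ?thesis using 1 by simp
  next
    case 2
    then have "[a = b + 1] (mod m)" using assms u_eq_iff by metis
    then have "[a - 1 = b + 1 - 1] (mod m)" by (intro cong_diff) auto
    then have "u (a - 1) = u b" using vertex_cong by fastforce
    then show ?thesis using 2 by simp
  qed
qed

text \<open>The direction \<open>s\<close> persists: turning back would give \<open>u n\<close> and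
  \<open>u (n + 2)\<close> the same antipode, which needs \<open>m\<close> to divide 2. Two
  consecutive indices are carried along because the step refers to the previous antipode.\<close>

lemma antipode_progression:
  assumes "u a = - u 0" "u (a + s) = - u 1" "s = 1 \<or> s = -1"
  shows "u (a + s * int n) = - u (int n) \<and> u (a + s * int (Suc n)) = - u (int (Suc n))"
proof (induction n)
  case 0
  then show ?case using assms by simp
next
  case (Suc n)
  let ?b = "a + s * int (Suc n)"
  have "u (?b + 1) = - u (int (Suc n) + 1) \<or> u (?b - 1) = - u (int (Suc n) + 1)"
    using Suc by (intro neighbour_of_antipode) simp
  then have "u (?b + s) = - u (int (Suc n) + 1) \<or> u (?b - s) = - u (int (Suc n) + 1)"
    using assms(3) by auto
  moreover have "u (?b - s) \<noteq> - u (int (Suc n) + 1)"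
  proof
    assume "u (?b - s) = - u (int (Suc n) + 1)"
    moreover have "u (?b - s) = - u (int n)" using Suc by (simp add: algebra_simps)
    ultimately have "u (int n) = u (int n + 2)" by (simp add: add.commute)
    then have "[int n = int n + 2] (mod m)" by (simp add: u_eq_iff)
    then have "m dvd 2" by (simp add: cong_iff_dvd_diff)
    then show False using m zdvd_imp_le[of m 2] by simp
  qed
  ultimately show ?case using Suc by (simp add: algebra_simps)
qed

lemma antipodal_shift: "\<exists>k. length Q = 2 * k \<and> (\<forall>i. u (i + int k) = - u i)"
proof -
  obtain a' where a': "u a' = - u 0" using antipode_of_vertex[of 0] by auto
  define a where "a = a' mod m"
  have a: "u a = - u 0" "0 \<le> a" "a < m"
    using a' vertex_cong[of a a' Q] mod_m[of a'] by (auto simp: a_def cong_def)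
  obtain s where s: "s = 1 \<or> s = - 1" "u (a + s) = - u 1"
    using neighbour_of_antipode[OF a(1)] by (metis add_0 add_uminus_conv_diff)
  have prog: "u (a + s * n) = - u n" if "n \<ge> 0" for n
    using antipode_progression[OF a(1) s(2,1), of "nat n"] that by simp
  have "s = 1"
  proof (rule ccontr)
    assume "s \<noteq> 1"
    then have neg: "u (a - n) = - u n" if "n \<ge> 0" for n using prog[OF that] s by simp
    show False
    \<comment> \<open>The index reflection taking \<open>n\<close> to \<open>a - n\<close> fixes a
      vertex if \<open>a\<close> is even and swaps the ends of an edge if \<open>a\<close> is odd. A
      vertex would then be its own antipode, or two consecutive vertices would be antipodal.\<close>
    proof (cases "even a")
      case True
      then obtain c where c: "a = 2 * c" by blast
      then have "u c = - u c" using neg[of c] a(2) by simp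
      then show False using u_neq_uminus by blast
    next
      case False
      then obtain c where c: "a = 2 * c + 1" using oddE by blast
      then have "u (c + 1) = - u c" using neg[of c] a(2) by (simp add: algebra_simps)
      then show False using not_antipodal by blast
    qed
  qed
  then have shift: "u (a + n) = - u n" if "n \<ge> 0" for n using prog[OF that] by simp
  have shift': "u (i + a) = - u i" for i
  proof -
    have "u (i mod m + a) = - u (i mod m)" using shift[of "i mod m"] mod_m[of i] by (simp add: add.commute)
    moreover have "u (i mod m + a) = u (i + a)" "u (i mod m) = u i"
      by (intro vertex_cong; simp add: cong_def mod_simps)+
    ultimately show ?thesis by simp
  qed
  have "u (a + a) = u 0" using shift'[of a] a(1) by simp
  \<comment> \<open>The antipodal map is an involution, so the rotation by \<open>a\<close> applied
    twice is trivial; as \<open>0 < a < m\<close>, this leaves only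
    \<open>m = 2 * a\<close>.\<close>
  then have "m dvd 2 * a" using u_eq_iff by (simp add: cong_0_iff)
  then obtain t where t: "2 * a = m * t" by blast
  have "a \<noteq> 0"
  proof
    assume "a = 0"
    then show False using a(1) u_neq_uminus by simp
  qed
  then have "0 < m * t" "m * t < m * 2" using a t by auto
  then have "t = 1" using m by (simp add: zero_less_mult_iff)
  then have "length Q = 2 * nat a" using t a(2) by simp
  moreover have "int (nat a) = a" using a(2) by simp
  ultimately show ?thesis using shift' by metis
qed

end

section \<open>Counting inflections and sign changes\<close>

text \<open>Inflections are unordered pairs, so counting them by index needs this injectivity. Equal
  pairs in swapped order would make the number of vertices divide 2.\<close>

lemma doubleton_edge_eq:
  assumes "distinct Q" "length Q \<ge> 3"
    and "{vertex Q i, vertex Q (i + 1)} = {vertex Q j, vertex Q (j + 1)}"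
  shows "[i = j] (mod int (length Q))"
proof -
  have Q: "Q \<noteq> []" using assms(2) by auto
  from assms(3) consider "vertex Q i = vertex Q j"
    | "vertex Q i = vertex Q (j + 1)" "vertex Q (i + 1) = vertex Q j"
    by (auto simp: doubleton_eq_iff)
  then show ?thesis
  proof cases
    case 1
    then show ?thesis using vertex_eq_iff[OF assms(1) Q] by simp
  next
    case 2
    then have "[i = j + 1] (mod int (length Q))" "[i + 1 = j] (mod int (length Q))"
      using vertex_eq_iff[OF assms(1) Q] by auto
    then have "int (length Q) dvd (i + 1 - j) - (i - (j + 1))"
      unfolding cong_iff_dvd_diff by (rule dvd_diff[rotated])
    then have "int (length Q) dvd 2" by simp
    then show ?thesis using zdvd_imp_le[of "int (length Q)" 2] assms(2) by simp
  qed
qed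

lemma card_inflections_ge:
  assumes "distinct Q" "length Q \<ge> 3" "finite I"
    and incong: "\<And>i j. i \<in> I \<Longrightarrow> j \<in> I \<Longrightarrow> [i = j] (mod int (length Q)) \<Longrightarrow> i = j"
    and infl: "\<And>i. i \<in> I \<Longrightarrow> {vertex Q i, vertex Q (i + 1)} \<in> spherical_inflections Q"
  shows "card I \<le> card (spherical_inflections Q)"
proof -
  let ?f = "\<lambda>i. {vertex Q i, vertex Q (i + 1)}"
  have "inj_on ?f I"
    using doubleton_edge_eq[OF assms(1,2)] incong by (intro inj_onI) blast
  then have "card I = card (?f ` I)" by (rule card_image[symmetric])
  also have "\<dots> \<le> card (spherical_inflections Q)"
  proof (rule card_mono)
    have "spherical_inflections Q \<subseteq> ?f ` {0..<int (length Q)}"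
      by (auto simp: spherical_inflections_def)
    then show "finite (spherical_inflections Q)" by (rule finite_subset) simp
  qed (use infl in auto)
  finally show ?thesis .
qed

lemma change_between:
  fixes P :: "int \<Rightarrow> bool"
  assumes "x \<le> y" "P x \<noteq> P y"
  shows "\<exists>i. x \<le> i \<and> i < y \<and> P i \<noteq> P (i + 1)"
  using assms
proof (induction y rule: int_ge_induct)
  case (step y)
  show ?case
  proof (cases "P y = P x")
    case True
    then show ?thesis using step by (intro exI[of _ y]) auto
  next
    case False
    then obtain i where "x \<le> i" "i < y" "P i \<noteq> P (i + 1)" using step by auto
    then show ?thesis by (intro exI[of _ i]) auto
  qed
qed simp

text \<open>After a change at \<open>a\<close>, the value of \<open>P (a + 1)\<close> must be lost
  before \<open>a + k\<close>, and it is back at \<open>a + k\<close> because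
  \<open>P (a + k)\<close> is the negation of \<open>P a\<close>. This forces two further
  changes.\<close>

lemma three_changes:
  fixes P :: "int \<Rightarrow> bool"
  assumes anti: "\<And>i. P (i + int k) \<longleftrightarrow> \<not> P i"
    and run: "\<And>s b. \<exists>n. 1 \<le> n \<and> n < k \<and> P (s + int n) \<noteq> b"
  obtains a b c where "a < b" "b < c" "c < a + int k"
    "P a \<noteq> P (a + 1)" "P b \<noteq> P (b + 1)" "P c \<noteq> P (c + 1)"
proof -
  obtain a where a: "P a \<noteq> P (a + 1)"
    using change_between[of 0 "int k" P] anti[of 0] by auto
  obtain n where n: "1 \<le> n" "n < k" "P (a + int n) \<noteq> P (a + 1)" using run by blast
  obtain b where b: "a + 1 \<le> b" "b < a + int n" "P b \<noteq> P (b + 1)"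
    using change_between[of "a + 1" "a + int n" P] n by auto
  obtain c where c: "a + int n \<le> c" "c < a + int k" "P c \<noteq> P (c + 1)"
    using change_between[of "a + int n" "a + int k" P] n a anti[of a] by auto
  show thesis using that[of a b c] a b c by simp
qed

section \<open>Inflections of the non-degenerate polygon\<close>

context symmetric_polygon
begin

text \<open>Otherwise half of the polygon would be a simple arc with turns of one sign that ends in
  the antipode of its start. Scaling by \<sigma> = -1 reverses the sign of every triple product and
  reduces right turns to left turns.\<close>

lemma polygon_changes_turn:
  assumes k: "length Q = 2 * k" "\<And>i. u (i + int k) = - u i" and sigma: "\<sigma> = 1 \<or> \<sigma> = - 1"
  shows "\<exists>n. 1 \<le> n \<and> n < k \<and> \<not> \<sigma> * triple (u (s + int n - 1)) (u (s + int n)) (u (s + int n + 1)) > 0"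
proof (rule ccontr)
  assume "\<not> ?thesis"
  then have pos: "\<sigma> * triple (u (s + int n - 1)) (u (s + int n)) (u (s + int n + 1)) > 0"
    if "1 \<le> n" "n < k" for n using that by blast
  interpret simple_arc "\<lambda>n. \<sigma> *\<^sub>R u (s + int n)" k
  proof (unfold_locales, goal_cases)
    case (1 i)
    have scale: "triple (\<sigma> *\<^sub>R x) (\<sigma> *\<^sub>R y) (\<sigma> *\<^sub>R z) = \<sigma> * triple x y z" for x y z
      using sigma by (auto simp: cross_minus_left cross_minus_right)
    show ?case unfolding scale using pos[of "Suc i"] 1 by (simp add: algebra_simps)
  next
    case (2 b l x)
    show ?case
    proof (rule ccontr)
      assume x: "x \<noteq> 0"
      have on_edge: "\<sigma> *\<^sub>R sgn x \<in> edge Q (s + int p)"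
        if xp: "x \<in> cone2 (\<sigma> *\<^sub>R u (s + int p)) (\<sigma> *\<^sub>R u (s + int (Suc p)))" for p
      proof -
        obtain a c where ac: "a \<ge> 0" "c \<ge> 0"
          "x = a *\<^sub>R \<sigma> *\<^sub>R u (s + int p) + c *\<^sub>R \<sigma> *\<^sub>R u (s + int (Suc p))"
          using xp by (auto simp: cone2_def)
        have "\<sigma> *\<^sub>R x = a *\<^sub>R u (s + int p) + c *\<^sub>R u (s + int p + 1)"
          using sigma by (auto simp: ac(3) add.commute add.left_commute)
        then have "inverse (norm x) *\<^sub>R (\<sigma> *\<^sub>R x)
            = (a / norm x) *\<^sub>R u (s + int p) + (c / norm x) *\<^sub>R u (s + int p + 1)"
          by (simp only: scaleR_add_right scaleR_scaleR divide_inverse_commute)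
        moreover have "\<sigma> *\<^sub>R sgn x = inverse (norm x) *\<^sub>R (\<sigma> *\<^sub>R x)"
          by (simp add: sgn_div_norm mult.commute)
        ultimately have "\<sigma> *\<^sub>R sgn x = (a / norm x) *\<^sub>R u (s + int p) + (c / norm x) *\<^sub>R u (s + int p + 1)"
          by simp
        moreover have "norm (\<sigma> *\<^sub>R sgn x) = 1" using sigma x by (auto simp: norm_sgn)
        ultimately show ?thesis
          unfolding edge_def great_circle_segment_def mem_Collect_eq
          using ac by (intro conjI exI[of _ "a / norm x"] exI[of _ "c / norm x"]) auto
      qed
      have "edge Q (s + int b) \<inter> edge Q (s + int l) \<noteq> {}"
        using on_edge[OF 2(3)] on_edge[OF 2(4)] by blast
      then have "[s + int l = s + int b - 1] (mod m) \<or> [s + int l = s + int b] (mod m)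
          \<or> [s + int l = s + int b + 1] (mod m)"
        using simple unfolding simple_polygon_def by blast
      \<comment> \<open>Inside half a period the index difference is too small for the edges to be
        adjacent around the other side: \<open>0 < t \<le> k < m\<close>.\<close>
      then obtain t where t: "m dvd t" "t = int l - int b + 1 \<or> t = int l - int b \<or> t = int l - int b - 1"
        by (auto simp: cong_iff_dvd_diff algebra_simps)
      then have "m \<le> t" using 2(1) by (intro zdvd_imp_le) auto
      then show False using t(2) 2(1,2) k(1) long by auto
    qed
  qed
  have "k \<ge> 2" using k(1) long by simp
  then show False using endpoint_not_antipodal k(2)[of s] by simp
qed

lemma card_inflections_ge_6: "card (spherical_inflections Q) \<ge> 6"
proof -
  obtain k where k: "length Q = 2 * k" "\<And>i. u (i + int k) = - u i" using antipodal_shift by blast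
  define d where "d i = triple (u (i - 1)) (u i) (u (i + 1))" for i
  have d0: "d i \<noteq> 0" for i by (simp add: d_def triple_nonzero)
  have dk: "d (i + int k) = - d i" for i
  proof -
    have "u (i + int k - 1) = - u (i - 1)" "u (i + int k + 1) = - u (i + 1)"
      using k(2)[of "i - 1"] k(2)[of "i + 1"] by (simp_all add: algebra_simps)
    then show ?thesis by (simp add: d_def k(2) cross_minus_left cross_minus_right)
  qed
  obtain a b c where abc: "a < b" "b < c" "c < a + int k" "(d a > 0) \<noteq> (d (a + 1) > 0)"
    "(d b > 0) \<noteq> (d (b + 1) > 0)" "(d c > 0) \<noteq> (d (c + 1) > 0)"
  proof (rule three_changes[of "\<lambda>i. d i > 0" k])
    show "d (i + int k) > 0 \<longleftrightarrow> \<not> d i > 0" for i using dk[of i] d0[of i] by linarith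
    show "\<exists>n. 1 \<le> n \<and> n < k \<and> (d (s + int n) > 0) \<noteq> sg" for s sg
    proof -
      obtain n where n: "1 \<le> n" "n < k" "\<not> (if sg then 1 else - 1) * d (s + int n) > 0"
        using polygon_changes_turn[OF k, of "if sg then 1 else - 1" s, folded d_def] by (cases sg; simp; blast)
      then show ?thesis using d0[of "s + int n"] by (intro exI[of _ n]) (cases sg; simp)
    qed
  qed
  \<comment> \<open>The antipodal shift repeats the three changes. All six indices lie in
    \<open>a, \<dots>, a + 2 * k - 1\<close>, so they are pairwise incongruent.\<close>
  let ?I = "{a, b, c, a + int k, b + int k, c + int k}"
  have change: "d i * d (i + 1) < 0" if "i \<in> ?I" for i
  proof -
    have "d i * d (i + 1) < 0" if "(d i > 0) \<noteq> (d (i + 1) > 0)" for i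
      using that d0[of i] d0[of "i + 1"] by (smt (verit) mult_less_0_iff)
    moreover have "d (i + int k) * d (i + int k + 1) = d i * d (i + 1)" for i
      using dk[of i] dk[of "i + 1"] by (simp add: algebra_simps)
    ultimately show ?thesis using that abc by auto
  qed
  have "card ?I = 6" using abc by auto
  moreover have "card ?I \<le> card (spherical_inflections Q)"
  proof (rule card_inflections_ge)
    show "distinct Q" using simple by (simp add: simple_polygon_def)
    show "length Q \<ge> 3" using long by simp
    show "i = j" if "i \<in> ?I" "j \<in> ?I" "[i = j] (mod m)" for i j
    proof -
      have "(l - a) mod m = l - a" if "l \<in> ?I" for l
      proof -
        have "m = 2 * int k" using k(1) by simp
        then have "0 \<le> l - a" "l - a < m" using that abc(1-3) by force+
        then show ?thesis by (rule mod_pos_pos_trivial)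
      qed
      then have "(i - a) mod m = i - a" "(j - a) mod m = j - a" using that(1,2) by blast+
      moreover have "(i - a) mod m = (j - a) mod m"
        using that(3) cong_diff[of i j m a a] by (simp add: cong_def)
      ultimately show ?thesis by linarith
    qed
    show "{u i, u (i + 1)} \<in> spherical_inflections Q" if "i \<in> ?I" for i
    proof -
      have red: "u (i mod m + e) = u (i + e)" for e
        by (rule vertex_cong) (simp add: cong_def mod_simps)
      have "det (vector [u (i - 1), u i, u (i + 1)] :: real^3^3)
          * det (vector [u i, u (i + 1), u (i + 2)] :: real^3^3) = d i * d (i + 1)"
        by (simp add: d_def cross3_simps)
      then have "strictly_separated_by_plane (u i) (u (i + 1)) (u (i - 1)) (u (i + 2))"
        using change[OF that] strictly_separated_by_plane_iff_det by simp
      then show ?thesis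
        unfolding spherical_inflections_def mem_Collect_eq
        \<comment> \<open>The index is reduced modulo \<open>m\<close> because inflections are
          indexed by \<open>0, \<dots>, m - 1\<close>.\<close>
        using red[of 0] red[of 1] red[of "- 1"] red[of 2] mod_m[of i]
        by (intro exI[of _ "i mod m"]) auto
    qed
  qed simp
  ultimately show ?thesis by simp
qed

end

theorem theorem6p2:
  fixes n :: int and Q :: "(real^3) list"
  assumes "2 * n \<ge> 6"
    and "spherical_polygon Q"
    and "simple_polygon Q"
    and "centrally_symmetric Q"
    and "int (length Q) \<ge> 2 * n"
    and "in_great_circle Q \<or> no_three_consecutive_on_great_circle Q"
  shows "card (spherical_inflections Q) \<ge> 6"
proof -
  have len: "length Q \<ge> 6" using assms by linarith
  show ?thesis
  proof (cases "in_great_circle Q")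
    case True
    \<comment> \<open>On a great circle every edge counts by convention, so the number of vertices
      is the bound.\<close>
    have "card {0..<int (length Q)} \<le> card (spherical_inflections Q)"
    proof (rule card_inflections_ge)
      show "distinct Q" using assms(3) by (simp add: simple_polygon_def)
      show "{vertex Q i, vertex Q (i + 1)} \<in> spherical_inflections Q" if "i \<in> {0..<int (length Q)}" for i
        using that True by (auto simp: spherical_inflections_def)
    qed (use len in \<open>auto simp: cong_def\<close>)
    then show ?thesis using len by simp
  next
    case False
    then interpret symmetric_polygon Q
      using assms len by unfold_locales auto
    show ?thesis by (rule card_inflections_ge_6)
  qed
qed

end
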